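(* Let $0<q<1$ be fixed. The functions $$x\mapsto\psi_q'(x)-\frac{(\ln q)^2q^x}{(1-q)(1-q^x)}-\frac{(\ln q)^2q^{2x}}{(1+q)(1-q^x)^2}$$ and $$x\mapsto-\psi_q'(x+1/2)+\frac{(\ln q)^2q^{x+1/2}}{(1-q)(1-q^x)}$$ are completely monotonic on $(0,+\infty)$.
   Context: For $0<q<1$ and $x>0$, the $q$-gamma function is $$\Gamma_q(x)=\frac{(q;q)_\infty}{(q^x;q)_\infty}(1-q)^{1-x},\qquad (a;q)_\infty=\prod_{n=0}^\infty(1-aq^n),$$ and $\psi_q=\Gamma_q'/\Gamma_q$ is its logarithmic derivative on $(0,+\infty)$. A function $f$ is completely monotonic on $(a,b)$ if it has derivatives of all orders there and $(-1)^kf^{(k)}(x)\geq0$ for all $x\in(a,b)$ and all integers $k\geq0$. *)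

theory Defs
  imports "HOL-Analysis.Analysis"
begin

definition q_pochhammer_inf :: "real \<Rightarrow> real \<Rightarrow> real" where
  "q_pochhammer_inf a q = (\<Prod>n. 1 - a * q ^ n)"

text \<open>The next two functions are meant for \<open>0 < q < 1\<close> and \<open>x > 0\<close>; their values at
  other arguments have no significance.\<close>

definition q_Gamma :: "real \<Rightarrow> real \<Rightarrow> real" where
  "q_Gamma q x =
     q_pochhammer_inf q q / q_pochhammer_inf (q powr x) q * (1 - q) powr (1 - x)"

definition q_psi :: "real \<Rightarrow> real \<Rightarrow> real" where
  "q_psi q x = deriv (q_Gamma q) x / q_Gamma q x"

text \<open>Meant for an open interval \<open>I\<close>, possibly unbounded: \<open>deriv\<close> is the two-sided
  derivative, so on an open set the iterates of \<open>deriv\<close> depend only on \<open>f\<close> there.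
  As \<open>deriv\<close> is total, the existence of all derivatives is required explicitly.\<close>

definition completely_monotonic_on :: "real set \<Rightarrow> (real \<Rightarrow> real) \<Rightarrow> bool" where
  "completely_monotonic_on I f \<longleftrightarrow>
     (\<forall>k. \<forall>x\<in>I. (deriv ^^ k) f differentiable (at x)) \<and>
     (\<forall>k. \<forall>x\<in>I. (-1) ^ k * (deriv ^^ k) f x \<ge> 0)"

end

theory Submission
  imports Defs
begin

text \<open>With \<open>y = q\<^sup>x\<close>, taking logarithms in the infinite product gives
  \<open>\<Gamma>\<^sub>q(x) = C (1 - q)\<^bsup>1-x\<^esup> exp (\<Sum>n\<ge>1. y\<^sup>n / (n (1 - q\<^sup>n)))\<close>. Differentiating in \<open>x\<close> multiplies
  the coefficient of \<open>y\<^sup>n\<close> by \<open>n ln q\<close>, so \<open>\<psi>\<^sub>q' = (ln q)\<^sup>2 \<Sum>n\<ge>1. n y\<^sup>n / (1 - q\<^sup>n)\<close>, and since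
  \<open>ln q < 0\<close> a power series in \<open>q\<^sup>x\<close> with nonnegative coefficients is completely monotonic. Both
  claims thus reduce to the nonnegativity of coefficients, which follows by induction on \<open>n\<close>
  from Bernoulli's inequality.\<close>

section \<open>Polynomial inequalities and the resulting coefficient bounds\<close>

text \<open>Bernoulli's inequality for \<open>(1 + (t - 1)) ^ Suc n\<close>; up to a power of
  \<open>r\<close>, this is the induction increment in
  \<open>geometric_sum_square_ge\<close>.\<close>

lemma Bernoulli_poly_nonneg:
  fixes t :: real
  assumes "0 \<le> t"
  shows "0 \<le> real n + t ^ Suc n - real (Suc n) * t"
  using Bernoulli_inequality[of "t - 1" "Suc n"] assms by (simp add: algebra_simps)

text \<open>The reciprocal polynomial of the preceding one. It is 0 for \<open>n = 0\<close>, and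
  consecutive ones differ by a nonnegative multiple of \<open>(1 - t)\<^sup>2\<close>.\<close>

lemma reverse_Bernoulli_poly_nonneg:
  fixes t :: real
  assumes "0 \<le> t"
  shows "0 \<le> 1 + real n * t ^ Suc n - real (Suc n) * t ^ n"
proof (induction n)
  case (Suc n)
  have "1 + real (Suc n) * t ^ Suc (Suc n) - real (Suc (Suc n)) * t ^ Suc n
      = (1 + real n * t ^ Suc n - real (Suc n) * t ^ n) + real (Suc n) * (t ^ n * (1 - t)\<^sup>2)"
    by (simp add: algebra_simps power2_eq_square)
  moreover have "0 \<le> real (Suc n) * (t ^ n * (1 - t)\<^sup>2)"
    using assms by simp
  ultimately show ?case using Suc by linarith
qed simp

text \<open>Adding \<open>2 * t ^ n\<close> to both sides compares the mean of
  \<open>1, t, ..., t ^ n\<close> with the mean of its two end terms: convexity in the exponent. In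
  the induction the gap grows by exactly the polynomial of
  \<open>reverse_Bernoulli_poly_nonneg\<close>.\<close>

lemma two_geometric_sum_le:
  fixes t :: real
  assumes "0 \<le> t"
  shows "2 * (\<Sum>k<n. t ^ k) \<le> real n + 1 + (real n - 1) * t ^ n"
proof (induction n)
  case (Suc n)
  then show ?case
    using reverse_Bernoulli_poly_nonneg[OF assms, of n] by (simp add: algebra_simps)
qed simp

text \<open>AM-GM for the powers \<open>r ^ (2 * k)\<close>, \<open>k \<le> n\<close>, whose
  geometric mean is \<open>r ^ n\<close>.\<close>

lemma geometric_sum_square_ge:
  fixes r :: real
  assumes "0 \<le> r"
  shows "real (Suc n) * r ^ n \<le> (\<Sum>k<Suc n. r ^ (2 * k))"
proof (induction n)
  case (Suc n)
  have pow: "r ^ (2 * Suc n) = r ^ n * r ^ Suc (Suc n)"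
    by (simp add: mult_2 flip: power_add power_Suc)
  \<comment> \<open>This product is the growth of the gap between the two sides from
    \<open>n\<close> to \<open>Suc n\<close>.\<close>
  have "0 \<le> r ^ n * (real (Suc n) + r ^ Suc (Suc n) - real (Suc (Suc n)) * r)"
    using Bernoulli_poly_nonneg[OF assms, of "Suc n"] assms by (intro mult_nonneg_nonneg) auto
  also have "\<dots> = real (Suc n) * r ^ n + r ^ (2 * Suc n) - real (Suc (Suc n)) * r ^ Suc n"
    unfolding pow by (simp add: algebra_simps)
  finally show ?case using Suc by simp
qed simp

text \<open>Gives the coefficients of the first function their sign. Equality holds for
  \<open>n = 1\<close> and \<open>n = 2\<close>: the two subtracted terms cancel exactly these
  coefficients.\<close>

lemma psi_coeff_lower_bound:
  fixes q :: real
  assumes q: "0 < q" "q < 1" and n: "n \<ge> 1"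
  shows "1 / (1 - q) + (real n - 1) / (1 + q) \<le> real n / (1 - q ^ n)"
proof -
  obtain m where m: "n = Suc m" using n by (cases n) auto
  have geo: "1 - q ^ k = (1 - q) * (\<Sum>i<k. q ^ i)" for k
    by (rule one_diff_power_eq)
  have qn: "q ^ n < 1" using q n by (simp add: power_less_one_iff)
  \<comment> \<open>With denominators cleared, the claim for \<open>n = Suc m\<close> is
    \<open>q\<close> times this inequality, hence the index \<open>m\<close>.\<close>
  have "2 * (1 - q ^ m) \<le> (1 - q) * (real m + 1 + (real m - 1) * q ^ m)"
    using mult_left_mono[OF two_geometric_sum_le[of q m], of "1 - q"] q
    by (simp add: geo mult_ac)
  then have "0 \<le> q * ((1 - q) * (real m + 1 + (real m - 1) * q ^ m) - 2 * (1 - q ^ m))"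
    using q by simp
  also have "\<dots> = real n * (1 - q) * (1 + q) - ((1 + q) + (real n - 1) * (1 - q)) * (1 - q ^ n)"
    by (simp add: m algebra_simps)
  finally have "((1 + q) + (real n - 1) * (1 - q)) * (1 - q ^ n) \<le> real n * ((1 - q) * (1 + q))"
    by simp
  then have "((1 + q) + (real n - 1) * (1 - q)) / ((1 - q) * (1 + q)) \<le> real n / (1 - q ^ n)"
    using q qn by (intro mult_imp_div_pos_le) (simp_all add: pos_le_divide_eq)
  moreover have "((1 + q) + (real n - 1) * (1 - q)) / ((1 - q) * (1 + q))
      = 1 / (1 - q) + (real n - 1) / (1 + q)"
    using q by (simp add: add_frac_eq)
  ultimately show ?thesis by simp
qed

text \<open>After division by \<open>1 - q\<close> the sum of \<open>q ^ k\<close>,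
  \<open>k < n\<close>, appears, and AM-GM applies to its terms. The factor
  \<open>sqrt q ^ n\<close> stems from the shift by 1/2 in the second function.\<close>

lemma psi_coeff_upper_bound:
  fixes q :: real
  assumes q: "0 < q" "q < 1" and n: "n \<ge> 1"
  shows "real n * sqrt q ^ n / (1 - q ^ n) \<le> sqrt q / (1 - q)"
proof -
  obtain m where m: "n = Suc m" using n by (cases n) auto
  define r where "r = sqrt q"
  have r: "r \<ge> 0" and qr: "r\<^sup>2 = q" using q by (auto simp: r_def)
  have qn: "q ^ n < 1" using q n by (simp add: power_less_one_iff)
  have "real n * r ^ m \<le> (\<Sum>k<n. q ^ k)"
    using geometric_sum_square_ge[OF r, of m] by (simp only: m power_mult qr)
  then have "r * (1 - q) * (real n * r ^ m) \<le> r * (1 - q) * (\<Sum>k<n. q ^ k)"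
    using r q by (intro mult_left_mono) auto
  also have "\<dots> = r * (1 - q ^ n)"
    by (simp add: one_diff_power_eq)
  finally have "(real n * r ^ n) * (1 - q) \<le> r * (1 - q ^ n)"
    by (simp add: m mult_ac)
  then show ?thesis
    using q qn unfolding r_def[symmetric] by (simp add: divide_simps)
qed

section \<open>Power series in \<open>q powr x\<close> and complete monotonicity\<close>

lemma powr_less_one_base:
  fixes q x :: real
  assumes "0 < q" "q < 1" "0 < x"
  shows "q powr x < 1"
  using powr_less_mono2[of x q 1] assms by simp

text \<open>This is the operator y d/dy. Convergence is assumed on the whole disc because termwise
  differentiation at \<open>y\<close> uses points of larger modulus; the result converges on the
  same disc, so the step can be iterated.\<close>

lemma summable_mult_index:
  fixes c :: "nat \<Rightarrow> real"
  assumes c: "\<And>y. \<bar>y\<bar> < 1 \<Longrightarrow> summable (\<lambda>n. c n * y ^ n)" and y: "\<bar>y\<bar> < 1"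
  shows "(\<lambda>n. real n * c n * y ^ n) sums (y * (\<Sum>n. diffs c n * y ^ n))"
proof -
  have "summable (\<lambda>n. diffs c n * y ^ n)"
    using termdiff_converges[of y 1 c] c y by simp
  from sums_mult[OF diffs_equiv[OF this], of y]
  have "(\<lambda>n. y * (real n * c n * y ^ (n - Suc 0))) sums (y * (\<Sum>n. diffs c n * y ^ n))" .
  \<comment> \<open>At \<open>n = 0\<close> the factor \<open>real n\<close> makes the truncated
    exponent \<open>n - Suc 0\<close> harmless.\<close>
  moreover have "y * (real n * c n * y ^ (n - Suc 0)) = real n * c n * y ^ n" for n
    by (cases n) auto
  ultimately show ?thesis by simp
qed

text \<open>By the chain rule, d/dx acts on a series in \<open>y = q powr x\<close> as
  \<open>ln q\<close> times y d/dy, which again yields a series of this shape.\<close>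

lemma has_derivative_powser_powr:
  fixes c :: "nat \<Rightarrow> real"
  assumes c: "\<And>y. \<bar>y\<bar> < 1 \<Longrightarrow> summable (\<lambda>n. c n * y ^ n)"
    and q: "0 < q" "q < 1" and x: "0 < x"
  shows "((\<lambda>x. \<Sum>n. c n * (q powr x) ^ n) has_field_derivative
          (\<Sum>n. real n * ln q * c n * (q powr x) ^ n)) (at x)"
proof -
  define y where "y = q powr x"
  have y: "\<bar>y\<bar> < 1" using powr_less_one_base[OF q x] by (simp add: y_def)
  have D: "((\<lambda>z. \<Sum>n. c n * z ^ n) has_field_derivative (\<Sum>n. diffs c n * y ^ n)) (at (q powr x))"
    using termdiffs_strong'[of 1 c y] c y by (simp add: y_def)
  have E: "((\<lambda>x. q powr x) has_field_derivative y * ln q) (at x)"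
    unfolding y_def using q by (auto intro!: derivative_eq_intros)
  from sums_mult[OF summable_mult_index[OF c y], of "ln q"]
  have "(\<lambda>n. real n * ln q * c n * y ^ n) sums ((\<Sum>n. diffs c n * y ^ n) * (y * ln q))"
    by (simp add: mult_ac)
  with DERIV_chain2[OF D E] show ?thesis
    by (simp add: sums_iff y_def)
qed

lemma summable_mult_index_ln:
  fixes c :: "nat \<Rightarrow> real"
  assumes "\<And>y. \<bar>y\<bar> < 1 \<Longrightarrow> summable (\<lambda>n. c n * y ^ n)" and "\<bar>y\<bar> < 1"
  shows "summable (\<lambda>n. real n * ln q * c n * y ^ n)"
  using summable_mult[OF sums_summable[OF summable_mult_index[OF assms]], of "ln q"]
  by (simp add: mult_ac)

lemma completely_monotonic_on_powser_powr:
  fixes c :: "nat \<Rightarrow> real"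
  assumes c: "\<And>y. \<bar>y\<bar> < 1 \<Longrightarrow> summable (\<lambda>n. c n * y ^ n)" and nonneg: "\<And>n. 0 \<le> c n"
    and q: "0 < q" "q < 1"
    and f: "\<And>x. 0 < x \<Longrightarrow> f x = (\<Sum>n. c n * (q powr x) ^ n)"
  shows "completely_monotonic_on {0<..} f"
proof -
  define C where "C k n = (real n * ln q) ^ k * c n" for k n
  have C: "summable (\<lambda>n. C k n * y ^ n)" if "\<bar>y\<bar> < 1" for k y
    using that
  proof (induction k arbitrary: y)
    case 0
    then show ?case using c by (simp add: C_def)
  next
    case (Suc k)
    show ?case
      using summable_mult_index_ln[of "C k", OF Suc.IH Suc.prems] by (simp add: C_def mult_ac)
  qed
  have D: "((\<lambda>x. \<Sum>n. C k n * (q powr x) ^ n) has_field_derivative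
          (\<Sum>n. C (Suc k) n * (q powr x) ^ n)) (at x)" if "0 < x" for k x
    using has_derivative_powser_powr[of "C k", OF C q that] by (simp add: C_def mult_ac)
  \<comment> \<open>Agreement with the series on the open half-line suffices to transfer its
    derivative. The agreement is a premise because \<open>F\<close> serves both the induction for
    \<open>eq\<close> and, afterwards, differentiability.\<close>
  have F: "((deriv ^^ k) f has_field_derivative (\<Sum>n. C (Suc k) n * (q powr x) ^ n)) (at x)"
    if "0 < x" and "\<And>x. 0 < x \<Longrightarrow> (deriv ^^ k) f x = (\<Sum>n. C k n * (q powr x) ^ n)" for k x
    using has_field_derivative_transform_within_open[OF D[OF that(1)], of "{0<..}"] that by simp
  have eq: "(deriv ^^ k) f x = (\<Sum>n. C k n * (q powr x) ^ n)" if "0 < x" for k x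
    using that
  proof (induction k arbitrary: x)
    case 0
    then show ?case using f by (simp add: C_def)
  next
    case (Suc k)
    show ?case using DERIV_imp_deriv[OF F[OF Suc.prems Suc.IH]] by simp
  qed
  have "(-1) ^ k * (deriv ^^ k) f x \<ge> 0" if x: "0 < x" for k x
  proof -
    have "summable (\<lambda>n. C k n * (q powr x) ^ n)"
      using C powr_less_one_base[OF q x] by simp
    then have "(-1) ^ k * (deriv ^^ k) f x = (\<Sum>n. (-1) ^ k * (C k n * (q powr x) ^ n))"
      by (simp add: eq[OF x] suminf_mult)
    \<comment> \<open>The sign is absorbed into the power, whose base is then nonnegative.\<close>
    also have "\<dots> = (\<Sum>n. (real n * - ln q) ^ k * c n * (q powr x) ^ n)"
      by (simp add: C_def flip: mult.assoc power_mult_distrib)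
    also have "\<dots> \<ge> 0"
    proof (rule suminf_nonneg)
      show "summable (\<lambda>n. (real n * - ln q) ^ k * c n * (q powr x) ^ n)"
        using summable_mult[OF \<open>summable (\<lambda>n. C k n * (q powr x) ^ n)\<close>, of "(-1) ^ k"]
        by (simp add: C_def flip: mult.assoc power_mult_distrib)
      show "0 \<le> (real n * - ln q) ^ k * c n * (q powr x) ^ n" for n
        using q nonneg by (intro mult_nonneg_nonneg zero_le_power) (auto simp: mult_nonneg_nonpos)
    qed
    finally show ?thesis .
  qed
  moreover have "(deriv ^^ k) f differentiable at x" if "0 < x" for k x
    using F[OF that eq] real_differentiable_def by blast
  ultimately show ?thesis
    by (auto simp: completely_monotonic_on_def)
qed

section \<open>The infinite product as the exponential of a power series\<close>

text \<open>The coefficient at \<open>0\<close> vanishes because division by \<open>0\<close> yields \<open>0\<close>.\<close>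

definition log_q_coeff :: "real \<Rightarrow> nat \<Rightarrow> real" where
  "log_q_coeff q n = 1 / (real n * (1 - q ^ n))"

text \<open>For \<open>n \<ge> 1\<close> the denominators are at least \<open>1 - q\<close>, so a
  geometric series dominates.\<close>

lemma summable_log_q_coeff:
  fixes q y :: real
  assumes q: "0 < q" "q < 1" and y: "\<bar>y\<bar> < 1"
  shows "summable (\<lambda>n. log_q_coeff q n * y ^ n)"
proof (rule summable_comparison_test')
  show "summable (\<lambda>n. 1 / (1 - q) * \<bar>y\<bar> ^ n)"
    using y by (intro summable_mult summable_geometric) auto
  show "norm (log_q_coeff q n * y ^ n) \<le> 1 / (1 - q) * \<bar>y\<bar> ^ n" if "n \<ge> 1" for n
  proof -
    have "q ^ n \<le> q" using q that power_decreasing[of 1 n q] by simp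
    then have "1 * (1 - q) \<le> real n * (1 - q ^ n)"
      using that q by (intro mult_mono) auto
    then have "0 \<le> log_q_coeff q n" "log_q_coeff q n \<le> 1 / (1 - q)"
      using q by (auto simp: log_q_coeff_def intro!: divide_left_mono)
    then have "norm (log_q_coeff q n * y ^ n) = log_q_coeff q n * \<bar>y\<bar> ^ n"
      by (simp add: abs_mult power_abs)
    also have "\<dots> \<le> 1 / (1 - q) * \<bar>y\<bar> ^ n"
      using \<open>log_q_coeff q n \<le> 1 / (1 - q)\<close> by (intro mult_right_mono) auto
    finally show ?thesis .
  qed
qed

text \<open>Replacing \<open>y\<close> by \<open>q * y\<close> multiplies the \<open>n\<close>-th
  term by \<open>q ^ n\<close>; the difference cancels \<open>1 - q ^ n\<close> and leaves the
  logarithmic series. This accounts for one factor of the product.\<close>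

lemma log_q_coeff_telescope:
  fixes q y :: real
  assumes q: "0 < q" "q < 1" and y: "\<bar>y\<bar> < 1"
  shows "(\<Sum>n. log_q_coeff q n * y ^ n) - (\<Sum>n. log_q_coeff q n * (q * y) ^ n) = - ln (1 - y)"
proof -
  have qy: "\<bar>q * y\<bar> < 1"
    using q y mult_strict_mono[of q 1 "\<bar>y\<bar>" 1] by (simp add: abs_mult)
  have coeff: "log_q_coeff q n * y ^ n - log_q_coeff q n * (q * y) ^ n = y ^ n / real n" for n
  proof (cases "n = 0")
    case False
    then have "q ^ n < 1" using q by (simp add: power_less_one_iff)
    have "log_q_coeff q n * y ^ n - log_q_coeff q n * (q * y) ^ n
        = log_q_coeff q n * (1 - q ^ n) * y ^ n"
      by (simp add: power_mult_distrib algebra_simps)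
    with \<open>q ^ n < 1\<close> show ?thesis by (simp add: log_q_coeff_def)
  qed (simp add: log_q_coeff_def)
  have "(\<lambda>n. y ^ n / real n) sums - ln (1 - y)"
    using sums_minus[OF ln_series'[of "- y"]] y by simp
  moreover have "(\<lambda>n. y ^ n / real n) sums
      ((\<Sum>n. log_q_coeff q n * y ^ n) - (\<Sum>n. log_q_coeff q n * (q * y) ^ n))"
    unfolding coeff[symmetric]
    by (intro sums_diff summable_sums summable_log_q_coeff q y qy)
  ultimately show ?thesis by (rule sums_unique2[symmetric])
qed

text \<open>The logarithms of the factors telescope, and the remainder \<open>G (y * q ^ N)\<close>
  tends to \<open>G 0\<close> by continuity.\<close>

lemma q_pochhammer_inf_eq_exp:
  fixes q y :: real
  assumes q: "0 < q" "q < 1" and y: "\<bar>y\<bar> < 1"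
  shows "q_pochhammer_inf y q = exp (- (\<Sum>n. log_q_coeff q n * y ^ n))"
proof -
  define G where "G z = (\<Sum>n. log_q_coeff q n * z ^ n)" for z
  have small: "\<bar>y * q ^ n\<bar> < 1" for n
    using q y mult_le_one[of "\<bar>y\<bar>" "q ^ n"] mult_right_le_one_le[of "\<bar>y\<bar>" "q ^ n"]
    by (simp add: abs_mult power_le_one)
  have prod: "(\<Prod>i<N. 1 - y * q ^ i) = exp (G (y * q ^ N) - G y)" for N
  proof (induction N)
    case (Suc N)
    have "G (y * q ^ N) - G (y * q ^ Suc N) = - ln (1 - y * q ^ N)"
      using log_q_coeff_telescope[OF q small[of N]] by (simp add: G_def mult_ac)
    moreover have "1 - y * q ^ N = exp (ln (1 - y * q ^ N))"
      using small[of N] by simp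
    ultimately have "1 - y * q ^ N = exp (G (y * q ^ Suc N) - G (y * q ^ N))"
      by (metis minus_diff_eq minus_minus)
    then show ?case using Suc by (simp flip: exp_add)
  qed simp
  have "isCont G 0"
    using DERIV_isCont[OF termdiffs_strong'[of 1 "log_q_coeff q" 0]] summable_log_q_coeff[OF q]
    by (simp add: G_def[abs_def])
  moreover have "(\<lambda>N. y * q ^ N) \<longlonglongrightarrow> 0"
    using q by (intro tendsto_mult_right_zero LIMSEQ_realpow_zero) auto
  \<comment> \<open>\<open>G 0\<close> is the constant coefficient, which is 0 by the convention on
    division.\<close>
  moreover have "G 0 = 0" by (simp add: G_def powser_zero) (simp add: log_q_coeff_def)
  ultimately have "(\<lambda>N. G (y * q ^ N)) \<longlonglongrightarrow> 0"
    using isCont_tendsto_compose by fastforce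
  then have "(\<lambda>N. exp (G (y * q ^ N) - G y)) \<longlonglongrightarrow> exp (0 - G y)"
    by (intro tendsto_intros)
  then have "(\<lambda>N. \<Prod>i<N. 1 - y * q ^ i) \<longlonglongrightarrow> exp (- G y)"
    by (simp add: prod)
  then have "(\<lambda>N. \<Prod>i\<le>N. 1 - y * q ^ i) \<longlonglongrightarrow> exp (- G y)"
    by (simp add: LIMSEQ_lessThan_iff_atMost)
  \<comment> \<open>\<open>raw_has_prod\<close> demands a nonzero limit, which an exponential always
    is.\<close>
  then have "(\<lambda>i. 1 - y * q ^ i) has_prod exp (- G y)"
    by (simp add: has_prod_def raw_has_prod_def)
  then show ?thesis
    unfolding q_pochhammer_inf_def G_def by (rule has_prod_unique[symmetric])
qed

section \<open>Series for \<open>q_psi\<close> and its derivative\<close>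

text \<open>In the logarithmic derivative the constant \<open>K\<close> cancels, being nonzero as an
  exponential, and \<open>(1 - q) powr (1 - x)\<close> contributes \<open>- ln (1 - q)\<close>,
  which disappears in the next derivative.\<close>

lemma q_psi_series:
  fixes q x :: real
  assumes q: "0 < q" "q < 1" and x: "0 < x"
  shows "q_psi q x = (\<Sum>n. real n * ln q * log_q_coeff q n * (q powr x) ^ n) - ln (1 - q)"
proof -
  define K where "K = q_pochhammer_inf q q"
  define G where "G x = (\<Sum>n. log_q_coeff q n * (q powr x) ^ n)" for x
  define G' where "G' = (\<Sum>n. real n * ln q * log_q_coeff q n * (q powr x) ^ n)"
  have K: "K \<noteq> 0" using q_pochhammer_inf_eq_exp[OF q] q by (simp add: K_def)
  have eq: "q_Gamma q t = K * exp (G t) * (1 - q) powr (1 - t)" if "0 < t" for t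
    using q_pochhammer_inf_eq_exp[OF q, of "q powr t"] powr_less_one_base[OF q that]
    by (simp add: q_Gamma_def flip: K_def G_def) (simp add: exp_minus divide_inverse)
  have G: "(G has_field_derivative G') (at x)"
    unfolding G_def[abs_def] G'_def
    using has_derivative_powser_powr[OF summable_log_q_coeff[OF q] q x] .
  have "((\<lambda>t. K * exp (G t) * (1 - q) powr (1 - t)) has_field_derivative
      (K * exp (G x) * (1 - q) powr (1 - x)) * (G' - ln (1 - q))) (at x)"
    using q by (auto intro!: derivative_eq_intros G simp: algebra_simps)
  then have "(q_Gamma q has_field_derivative q_Gamma q x * (G' - ln (1 - q))) (at x)"
    using has_field_derivative_transform_within_open[of _ _ x "{0<..}" "q_Gamma q"] x
    by (simp add: eq)
  then have "deriv (q_Gamma q) x = q_Gamma q x * (G' - ln (1 - q))"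
    by (rule DERIV_imp_deriv)
  moreover have "q_Gamma q x \<noteq> 0" using K q by (simp add: eq[OF x])
  ultimately show ?thesis by (simp add: q_psi_def G'_def)
qed

lemma deriv_q_psi_sums:
  fixes q x :: real
  assumes q: "0 < q" "q < 1" and x: "0 < x"
  shows "(\<lambda>n. (ln q)\<^sup>2 * (real n / (1 - q ^ n)) * (q powr x) ^ n) sums deriv (q_psi q) x"
proof -
  define c where "c n = real n * ln q * log_q_coeff q n" for n
  have c: "summable (\<lambda>n. c n * y ^ n)" if "\<bar>y\<bar> < 1" for y
    unfolding c_def using summable_mult_index_ln[OF summable_log_q_coeff[OF q] that] .
  \<comment> \<open>Both sides are 0 at \<open>n = 0\<close>, so no case split is needed.\<close>
  have coeff: "real n * ln q * c n = (ln q)\<^sup>2 * (real n / (1 - q ^ n))" for n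
    by (simp add: c_def log_q_coeff_def power2_eq_square)
  have "((\<lambda>x. (\<Sum>n. c n * (q powr x) ^ n) - ln (1 - q)) has_field_derivative
      (\<Sum>n. real n * ln q * c n * (q powr x) ^ n)) (at x)"
    using DERIV_diff[OF has_derivative_powser_powr[OF c q x] DERIV_const] by simp
  then have "(q_psi q has_field_derivative (\<Sum>n. real n * ln q * c n * (q powr x) ^ n)) (at x)"
    using has_field_derivative_transform_within_open[of _ _ x "{0<..}" "q_psi q"] x
    by (simp add: q_psi_series[OF q] c_def)
  then have "deriv (q_psi q) x = (\<Sum>n. real n * ln q * c n * (q powr x) ^ n)"
    by (rule DERIV_imp_deriv)
  moreover have "summable (\<lambda>n. real n * ln q * c n * (q powr x) ^ n)"
    using summable_mult_index_ln[OF c] powr_less_one_base[OF q x] by simp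
  ultimately show ?thesis by (simp add: coeff sums_iff)
qed

text \<open>Two applications of y d/dy to the logarithmic series. The whole disc is covered, as
  \<open>completely_monotonic_on_powser_powr\<close> requires.\<close>

lemma summable_psi_coeff:
  fixes q y :: real
  assumes q: "0 < q" "q < 1" and y: "\<bar>y\<bar> < 1"
  shows "summable (\<lambda>n. real n / (1 - q ^ n) * y ^ n)"
proof -
  have "summable (\<lambda>n. real n * (real n * log_q_coeff q n) * y ^ n)"
    using sums_summable[OF summable_mult_index[OF sums_summable[OF
          summable_mult_index[OF summable_log_q_coeff[OF q]]] y]] .
  moreover have "real n * (real n * log_q_coeff q n) = real n / (1 - q ^ n)" for n
    by (simp add: log_q_coeff_def)
  ultimately show ?thesis by simp
qed

section \<open>Expansions of the elementary terms\<close>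

lemma geometric_sums_pos:
  fixes y :: real
  assumes "\<bar>y\<bar> < 1"
  shows "(\<lambda>n. of_bool (n > 0) * y ^ n) sums (y / (1 - y))"
proof -
  have "(\<lambda>n. y * y ^ n) sums (y * (1 / (1 - y)))"
    using assms by (intro sums_mult geometric_sums) auto
  then show ?thesis
    using sums_Suc_imp[of "\<lambda>n. of_bool (n > 0) * y ^ n"] by simp
qed

text \<open>The coefficient is \<open>n - 1\<close> for \<open>n \<ge> 1\<close> but 0, not -1, at
  \<open>n = 0\<close>; all series thus share the index range from 0.\<close>

lemma geometric_sums_pred:
  fixes y :: real
  assumes y: "\<bar>y\<bar> < 1"
  shows "(\<lambda>n. (real n - of_bool (n > 0)) * y ^ n) sums (y\<^sup>2 / (1 - y)\<^sup>2)"
proof -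
  have "(\<lambda>n. y * (of_nat (Suc n) * y ^ n)) sums (y * (1 / (1 - y)\<^sup>2))"
    using y by (intro sums_mult geometric_deriv_sums) auto
  then have "(\<lambda>n. real n * y ^ n) sums (y * (1 / (1 - y)\<^sup>2))"
    using sums_Suc_imp[of "\<lambda>n. real n * y ^ n"] by (simp add: mult.left_commute)
  from sums_diff[OF this geometric_sums_pos[OF y]]
  have "(\<lambda>n. (real n - of_bool (n > 0)) * y ^ n) sums (y * (1 / (1 - y)\<^sup>2) - y / (1 - y))"
    by (simp add: left_diff_distrib)
  moreover have "y * (1 / (1 - y)\<^sup>2) - y / (1 - y) = y\<^sup>2 / (1 - y)\<^sup>2"
    using y by (auto simp: divide_simps power2_eq_square) algebra
  ultimately show ?thesis by simp
qed

section \<open>Comparison of coefficients for the two functions\<close>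

theorem theorem3p6:
  fixes q :: real
  assumes "0 < q" and "q < 1"
  shows "completely_monotonic_on {0<..}
           (\<lambda>x. deriv (q_psi q) x
              - (ln q)\<^sup>2 * q powr x / ((1 - q) * (1 - q powr x))
              - (ln q)\<^sup>2 * q powr (2 * x) / ((1 + q) * (1 - q powr x)\<^sup>2))
       \<and> completely_monotonic_on {0<..}
           (\<lambda>x. - deriv (q_psi q) (x + 1 / 2)
              + (ln q)\<^sup>2 * q powr (x + 1 / 2) / ((1 - q) * (1 - q powr x)))"
proof
  note q = assms
  define e :: "nat \<Rightarrow> real" where "e n = of_bool (n > 0)" for n
  have e: "(\<lambda>n. e n * y ^ n) sums (y / (1 - y))" if "\<bar>y\<bar> < 1" for y
    unfolding e_def using geometric_sums_pos[OF that] .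
  have e2: "(\<lambda>n. (real n - e n) * y ^ n) sums (y\<^sup>2 / (1 - y)\<^sup>2)" if "\<bar>y\<bar> < 1" for y
    unfolding e_def using geometric_sums_pred[OF that] .
  \<comment> \<open>The coefficients of the first function in powers of \<open>q powr x\<close>;
    \<open>e\<close> and \<open>e2\<close> expand the two subtracted terms.\<close>
  define c where "c n = (ln q)\<^sup>2 * (real n / (1 - q ^ n))
    - (ln q)\<^sup>2 / (1 - q) * e n - (ln q)\<^sup>2 / (1 + q) * (real n - e n)" for n
  have c_expand: "c n * y ^ n = (ln q)\<^sup>2 * (real n / (1 - q ^ n)) * y ^ n
      - (ln q)\<^sup>2 / (1 - q) * (e n * y ^ n) - (ln q)\<^sup>2 / (1 + q) * ((real n - e n) * y ^ n)"
    for n and y :: real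
    by (simp only: c_def left_diff_distrib mult.assoc)
  show "completely_monotonic_on {0<..}
           (\<lambda>x. deriv (q_psi q) x
              - (ln q)\<^sup>2 * q powr x / ((1 - q) * (1 - q powr x))
              - (ln q)\<^sup>2 * q powr (2 * x) / ((1 + q) * (1 - q powr x)\<^sup>2))"
  proof (rule completely_monotonic_on_powser_powr[where c = c, OF _ _ q])
    show "summable (\<lambda>n. c n * y ^ n)" if "\<bar>y\<bar> < 1" for y
      unfolding c_expand
      using summable_mult[OF summable_psi_coeff[OF q that], of "(ln q)\<^sup>2"]
        sums_summable[OF e[OF that]] sums_summable[OF e2[OF that]]
      by (intro summable_diff summable_mult) (auto simp: mult.assoc)
    show "0 \<le> c n" for n
    proof (cases "n = 0")
      case False
      have "c n = (ln q)\<^sup>2 * (real n / (1 - q ^ n) - (1 / (1 - q) + (real n - 1) / (1 + q)))"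
        using False by (simp add: c_def e_def right_diff_distrib distrib_left diff_divide_distrib)
      then show ?thesis
        using psi_coeff_lower_bound[OF q, of n] False by simp
    qed (simp add: c_def e_def)
    show "deriv (q_psi q) x
              - (ln q)\<^sup>2 * q powr x / ((1 - q) * (1 - q powr x))
              - (ln q)\<^sup>2 * q powr (2 * x) / ((1 + q) * (1 - q powr x)\<^sup>2)
          = (\<Sum>n. c n * (q powr x) ^ n)" if x: "0 < x" for x
    proof -
      define y where "y = q powr x"
      have y: "\<bar>y\<bar> < 1" using powr_less_one_base[OF q x] by (simp add: y_def)
      have y2: "q powr (2 * x) = y\<^sup>2"
        using powr_add[of q x x] by (simp add: y_def power2_eq_square)
      have "(\<lambda>n. c n * y ^ n) sums (deriv (q_psi q) x - (ln q)\<^sup>2 / (1 - q) * (y / (1 - y))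
          - (ln q)\<^sup>2 / (1 + q) * (y\<^sup>2 / (1 - y)\<^sup>2))"
        unfolding c_expand
        by (intro sums_diff sums_mult e e2 y deriv_q_psi_sums[OF q x, folded y_def])
      then show ?thesis
        by (simp add: sums_iff y2 flip: y_def)
    qed
  qed
  \<comment> \<open>The shift by 1/2 replaces \<open>y\<close> by \<open>sqrt q * y\<close>. In the
    series for the derivative of \<open>q_psi\<close> this gives \<open>sqrt q ^ n\<close>; in the
    elementary term only the numerator is shifted, which leaves a single
    \<open>sqrt q\<close>.\<close>
  define d where "d n = (ln q)\<^sup>2 * sqrt q / (1 - q) * e n
    - (ln q)\<^sup>2 * (real n / (1 - q ^ n)) * sqrt q ^ n" for n
  have d_expand: "d n * y ^ n = (ln q)\<^sup>2 * sqrt q / (1 - q) * (e n * y ^ n)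
      - (ln q)\<^sup>2 * (real n / (1 - q ^ n)) * (sqrt q * y) ^ n" for n and y :: real
    by (simp only: d_def left_diff_distrib mult.assoc power_mult_distrib)
  show "completely_monotonic_on {0<..}
           (\<lambda>x. - deriv (q_psi q) (x + 1 / 2)
              + (ln q)\<^sup>2 * q powr (x + 1 / 2) / ((1 - q) * (1 - q powr x)))"
  proof (rule completely_monotonic_on_powser_powr[where c = d, OF _ _ q])
    show "summable (\<lambda>n. d n * y ^ n)" if "\<bar>y\<bar> < 1" for y
    proof -
      have "\<bar>sqrt q * y\<bar> < 1"
        using q that mult_strict_mono[of "sqrt q" 1 "\<bar>y\<bar>" 1] by (simp add: abs_mult)
      then show ?thesis
        unfolding d_expand
        using summable_mult[OF summable_psi_coeff[OF q], of "sqrt q * y" "(ln q)\<^sup>2"]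
          sums_summable[OF e[OF that]]
        by (intro summable_diff summable_mult) (auto simp: mult.assoc)
    qed
    show "0 \<le> d n" for n
    proof (cases "n = 0")
      case False
      have "d n = (ln q)\<^sup>2 * (sqrt q / (1 - q) - real n * sqrt q ^ n / (1 - q ^ n))"
        using False by (simp add: d_def e_def algebra_simps)
      then show ?thesis
        using psi_coeff_upper_bound[OF q, of n] False by simp
    qed (simp add: d_def e_def)
    show "- deriv (q_psi q) (x + 1 / 2)
              + (ln q)\<^sup>2 * q powr (x + 1 / 2) / ((1 - q) * (1 - q powr x))
          = (\<Sum>n. d n * (q powr x) ^ n)" if x: "0 < x" for x
    proof -
      define y where "y = q powr x"
      have y: "\<bar>y\<bar> < 1" using powr_less_one_base[OF q x] by (simp add: y_def)
      have shift: "q powr (x + 1 / 2) = sqrt q * y"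
        using q by (simp add: y_def powr_add powr_half_sqrt)
      have "(\<lambda>n. (ln q)\<^sup>2 * (real n / (1 - q ^ n)) * (sqrt q * y) ^ n) sums deriv (q_psi q) (x + 1 / 2)"
        using deriv_q_psi_sums[OF q, of "x + 1 / 2"] x unfolding shift by simp
      then have "(\<lambda>n. d n * y ^ n) sums ((ln q)\<^sup>2 * sqrt q / (1 - q) * (y / (1 - y))
          - deriv (q_psi q) (x + 1 / 2))"
        unfolding d_expand by (intro sums_diff sums_mult e y)
      then show ?thesis
        unfolding shift by (simp add: sums_iff mult_ac flip: y_def)
    qed
  qed
qed

end
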